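(* Let $k\ge 2$ be an integer and set $n=2k-1$. Let $\lambda, c_2,\dots,c_k\in\mathbb{R}$ and define $f=(f_1,f_2)$ by $$f_1(x,y)=x+\sum_{i=2}^{k}c_i\,y^{i},\qquad f_2(x,y)=y+\lambda\,f_1(x,y).$$ Then $\det Df\equiv 1$ and the Hamiltonian $$\mathcal{H}(x,y)=\frac{f_1(x,y)^2+f_2(x,y)^2}{2}$$ generates a trivial isochronous center at the origin of degree $n=2k-1$. Moreover, $f$ is injective (it is a triangular map), hence the center is global.
   Context: The planar polynomial Hamiltonian system generated by $\mathcal{H}\in\mathbb{R}[x,y]$ (with $\mathcal{H}(0,0)=0$) is $\dot x=-\mathcal{H}_y(x,y)$, $\dot y=\mathcal{H}_x(x,y)$. Its degree is the maximum of the degrees of the polynomials $\mathcal{H}_y$ and $\mathcal{H}_x$, and the degree of the center is the degree of this system. The origin is a center if it is an equilibrium with a punctured neighborhood filled with nonconstant periodic orbits. It is isochronous (of period $2\pi$) if all periodic orbits in some punctured neighborhood of the origin have the same minimal period $2\pi$. An isochronous center at the origin is called trivial if $\mathcal{H}=\tfrac12(f_1^2+f_2^2)$ for some polynomial map $f=(f_1,f_2):\mathbb{R}^2\to\mathbb{R}^2$ with $\det Df\equiv 1$ and $f(0,0)=(0,0)$. The center is global if every orbit in $\mathbb{R}^2\setminus\{(0,0)\}$ is a nonconstant periodic orbit. $Df$ denotes the Jacobian matrix of $f$.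
   Formalization: The claim that the center has degree n = 2k−1 is proved under the condition c_k ≠ 0; it fails when c_k = 0 (for all c_i = 0 the system is linear, of degree 1). All other conclusions hold for arbitrary c_2,…,c_k. *)

theory Defs
  imports "HOL-Analysis.Analysis" "HOL-Computational_Algebra.Polynomial"
begin

text \<open>
  The ring of real polynomials in two variables \<open>x\<close>, \<open>y\<close> is represented by \<open>real poly poly\<close>,
  with \<open>y\<close> as the outer and \<open>x\<close> as the inner variable:
  \<open>coeff (coeff p j) i\<close> is the coefficient of \<open>x^i * y^j\<close>.
\<close>

type_synonym bipoly = "real poly poly"

definition PX :: bipoly where "PX = [:[:0, 1:]:]"

definition PY :: bipoly where "PY = [:0, 1:]"

definition PC :: "real \<Rightarrow> bipoly" where "PC a = [:[:a:]:]"

definition eval2 :: "bipoly \<Rightarrow> real \<Rightarrow> real \<Rightarrow> real" where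
  "eval2 p x y = poly (poly p [:y:]) x"

definition dx :: "bipoly \<Rightarrow> bipoly" where "dx p = map_poly pderiv p"

definition dy :: "bipoly \<Rightarrow> bipoly" where "dy p = pderiv p"

text \<open>Total degree; by convention the zero polynomial has degree 0.\<close>

definition total_degree :: "bipoly \<Rightarrow> nat" where
  "total_degree p = Max (insert 0 {i + j | i j. coeff (coeff p j) i \<noteq> 0})"

definition jacobian2 :: "bipoly \<Rightarrow> bipoly \<Rightarrow> real \<Rightarrow> real \<Rightarrow> real ^ 2 ^ 2" where
  "jacobian2 f1 f2 x y =
     vector [vector [eval2 (dx f1) x y, eval2 (dy f1) x y],
             vector [eval2 (dx f2) x y, eval2 (dy f2) x y]]"

lemma eval2_simps [simp]:
  "eval2 PX x y = x" "eval2 PY x y = y" "eval2 (PC a) x y = a"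
  "eval2 0 x y = 0" "eval2 1 x y = 1"
  "eval2 (p + q) x y = eval2 p x y + eval2 q x y"
  "eval2 (p * q) x y = eval2 p x y * eval2 q x y"
  "eval2 (p ^ m) x y = eval2 p x y ^ m"
  by (simp_all add: eval2_def PX_def PY_def PC_def)

lemma eval2_sum [simp]: "eval2 (sum g A) x y = (\<Sum>i\<in>A. eval2 (g i) x y)"
  by (induction A rule: infinite_finite_induct) simp_all

lemma eval2_pCons: "eval2 (pCons a p) x y = poly a x + y * eval2 p x y"
  by (simp add: eval2_def)

lemma has_real_derivative_dx:
  "((\<lambda>t. eval2 p t y) has_real_derivative eval2 (dx p) x y) (at x)"
proof (induction p)
  case 0
  then show ?case by (simp add: dx_def)
next
  case (pCons a p)
  have "eval2 (dx (pCons a p)) x y = poly (pderiv a) x + y * eval2 (dx p) x y"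
    by (simp add: dx_def eval2_pCons map_poly_pCons)
  then show ?case
    by (auto simp: eval2_pCons intro!: derivative_eq_intros poly_DERIV pCons.IH)
qed

lemma has_real_derivative_dy:
  "((\<lambda>t. eval2 p x t) has_real_derivative eval2 (dy p) x y) (at y)"
proof (induction p)
  case 0
  then show ?case by (simp add: dy_def)
next
  case (pCons a p)
  have "eval2 (dy (pCons a p)) x y = eval2 p x y + y * eval2 (dy p) x y"
    by (simp add: dy_def eval2_pCons pderiv_pCons)
  then show ?case
    by (auto simp: eval2_pCons intro!: derivative_eq_intros pCons.IH)
qed

text \<open>
  The system generated by \<open>H\<close> is \<open>x' = - H_y\<close>, \<open>y' = H_x\<close> (note the sign convention).
\<close>

definition ham_field :: "bipoly \<Rightarrow> real \<times> real \<Rightarrow> real \<times> real" where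
  "ham_field H = (\<lambda>(x, y). (- eval2 (dy H) x y, eval2 (dx H) x y))"

definition system_degree :: "bipoly \<Rightarrow> nat" where
  "system_degree H = max (total_degree (dy H)) (total_degree (dx H))"

definition ham_solution :: "bipoly \<Rightarrow> real set \<Rightarrow> (real \<Rightarrow> real \<times> real) \<Rightarrow> bool" where
  "ham_solution H I u \<longleftrightarrow>
     open I \<and> is_interval I \<and> I \<noteq> {} \<and>
     (\<forall>t\<in>I. (u has_vector_derivative ham_field H (u t)) (at t))"

definition maximal_solution :: "bipoly \<Rightarrow> real set \<Rightarrow> (real \<Rightarrow> real \<times> real) \<Rightarrow> bool" where
  "maximal_solution H I u \<longleftrightarrow>
     ham_solution H I u \<and>
     (\<forall>J w. ham_solution H J w \<and> I \<subseteq> J \<and> (\<forall>t\<in>I. w t = u t) \<longrightarrow> J = I)"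

definition is_orbit :: "bipoly \<Rightarrow> (real \<times> real) set \<Rightarrow> bool" where
  "is_orbit H S \<longleftrightarrow> (\<exists>I u. maximal_solution H I u \<and> S = u ` I)"

definition periodic_solution :: "bipoly \<Rightarrow> (real \<Rightarrow> real \<times> real) \<Rightarrow> bool" where
  "periodic_solution H u \<longleftrightarrow>
     ham_solution H UNIV u \<and> (\<exists>T>0. \<forall>t. u (t + T) = u t)"

definition nonconst_periodic_solution :: "bipoly \<Rightarrow> (real \<Rightarrow> real \<times> real) \<Rightarrow> bool" where
  "nonconst_periodic_solution H u \<longleftrightarrow> periodic_solution H u \<and> \<not> (\<exists>p. \<forall>t. u t = p)"

definition nonconst_periodic_orbit :: "bipoly \<Rightarrow> (real \<times> real) set \<Rightarrow> bool" where
  "nonconst_periodic_orbit H S \<longleftrightarrow> (\<exists>u. nonconst_periodic_solution H u \<and> S = range u)"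

lemma nonconst_periodic_orbit_is_orbit: "nonconst_periodic_orbit H S \<Longrightarrow> is_orbit H S"
  unfolding nonconst_periodic_orbit_def nonconst_periodic_solution_def
    periodic_solution_def is_orbit_def maximal_solution_def
  by (metis top.extremum_unique)

definition minimal_period :: "(real \<Rightarrow> real \<times> real) \<Rightarrow> real \<Rightarrow> bool" where
  "minimal_period u T \<longleftrightarrow>
     T > 0 \<and> (\<forall>t. u (t + T) = u t) \<and> (\<forall>S. 0 < S \<and> S < T \<longrightarrow> \<not> (\<forall>t. u (t + S) = u t))"

text \<open>The punctured neighbourhood is required to be a union of nonconstant periodic orbits.\<close>

definition center :: "bipoly \<Rightarrow> bool" where
  "center H \<longleftrightarrow>
     ham_field H (0, 0) = (0, 0) \<and>
     (\<exists>U. open U \<and> (0, 0) \<in> U \<and>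
        U - {(0, 0)} = \<Union>{S. nonconst_periodic_orbit H S \<and> S \<subseteq> U - {(0, 0)}})"

definition isochronous_center :: "bipoly \<Rightarrow> bool" where
  "isochronous_center H \<longleftrightarrow>
     center H \<and>
     (\<exists>U. open U \<and> (0, 0) \<in> U \<and>
        (\<forall>u. nonconst_periodic_solution H u \<and> range u \<subseteq> U - {(0, 0)} \<longrightarrow>
           minimal_period u (2 * pi)))"

definition trivial_isochronous_center :: "bipoly \<Rightarrow> bool" where
  "trivial_isochronous_center H \<longleftrightarrow>
     isochronous_center H \<and>
     (\<exists>f1 f2. H = PC (1 / 2) * (f1\<^sup>2 + f2\<^sup>2) \<and>
        (\<forall>x y. det (jacobian2 f1 f2 x y) = 1) \<and>
        eval2 f1 0 0 = 0 \<and> eval2 f2 0 0 = 0)"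

definition global_center :: "bipoly \<Rightarrow> bool" where
  "global_center H \<longleftrightarrow>
     center H \<and> (\<forall>S. is_orbit H S \<and> S \<subseteq> - {(0, 0)} \<longrightarrow> nonconst_periodic_orbit H S)"

end

theory Submission imports Defs begin

text \<open>
  For any polynomial map \<open>F = (f1, f2)\<close> of the plane that fixes the origin, the Hamiltonian \<open>H = (f1\<^sup>2 + f2\<^sup>2) / 2\<close>
  generates the vector field \<open>(- H_y, H_x)\<close>, and multiplying it by the Jacobian matrix of \<open>F\<close> gives
  \<open>det DF \<cdot> (- f2, f1)\<close>. If the determinant is \<open>1\<close>, then \<open>F\<close> therefore carries every solution to a
  solution of the linear system \<open>a' = - b\<close>, \<open>b' = a\<close>, that is, to a uniform rotation with angular
  speed \<open>1\<close> (\<open>ham_solution_eq_flow\<close>). If \<open>F\<close> is moreover a bijection, the inverse function theorem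
  makes its inverse differentiable, and pulling the rotations back through \<open>F\<close> yields solutions
  defined for all times through every point (\<open>flow_has_vector_derivative\<close>). So the system is
  globally conjugate to the rotation: every orbit other than the origin is periodic with minimal
  period \<open>2\<pi>\<close>, and the whole plane can serve as the neighbourhood in the definitions of a center and
  of an isochronous center. The locale \<open>unimodular_bijection\<close> carries out this argument.

  The triangular maps belong to this class. With \<open>g y = (\<Sum>i=2..k. c i * y ^ i)\<close>, the equations
  \<open>a = x + g y\<close>, \<open>b = y + lam * a\<close> are solved by \<open>y = b - lam * a\<close> and \<open>x = a - g y\<close>, and the
  Jacobian determinant is \<open>1 * (1 + lam * g' y) - g' y * lam = 1\<close>.

  For the degree of the system, \<open>H\<close> has total degree at most \<open>2 * k\<close>, and its coefficient at
  \<open>y ^ (2 * k)\<close> is \<open>(1 + lam\<^sup>2) * (c k)\<^sup>2 / 2\<close>, which cannot vanish when \<open>c k \<noteq> 0\<close>. Differentiation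
  lowers positive total degrees by at least one, and the derivative in \<open>y\<close> keeps that monomial, as a multiple
  of \<open>y ^ (2 * k - 1)\<close> (\<open>system_degree_eqI\<close>).
\<close>

section \<open>Rotations of the plane\<close>

definition rot :: "real \<Rightarrow> real \<times> real \<Rightarrow> real \<times> real" where
  "rot t = (\<lambda>(a, b). (cos t * a - sin t * b, sin t * a + cos t * b))"

lemma rot_zero [simp]: "rot 0 p = p"
  by (cases p) (simp add: rot_def)

lemma rot_origin [simp]: "rot t (0, 0) = (0, 0)"
  by (simp add: rot_def)

lemma rot_rot: "rot s (rot t p) = rot (s + t) p"
  by (cases p) (simp add: rot_def cos_add sin_add algebra_simps)

lemma rot_2pi [simp]: "rot (t + 2 * pi) p = rot t p"
  by (simp add: rot_def)

text \<open>
  Taking the inner product of both sides of \<open>rot t p = p\<close> with \<open>p\<close> gives \<open>cos t * |p|\<^sup>2 = |p|\<^sup>2\<close>.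
\<close>

lemma rot_fixes_imp_cos_eq_1:
  assumes "rot t p = p" and "p \<noteq> (0, 0)"
  shows "cos t = 1"
proof -
  obtain a b where p: "p = (a, b)" by (cases p)
  have 1: "cos t * a - sin t * b = a" and 2: "sin t * a + cos t * b = b"
    using assms by (simp_all add: p rot_def)
  have "cos t * (a * a + b * b)
      = (cos t * a - sin t * b) * a + (sin t * a + cos t * b) * b"
    by (simp add: algebra_simps)
  also have "\<dots> = a * a + b * b"
    by (simp only: 1 2)
  finally have "cos t * (a * a + b * b) = a * a + b * b" .
  moreover have "a * a + b * b \<noteq> 0"
    using assms by (simp add: p sum_squares_eq_zero_iff)
  ultimately show ?thesis by auto
qed

lemma rot_has_vector_derivative:
  "((\<lambda>t. rot t p) has_vector_derivative (- snd (rot t p), fst (rot t p))) (at t)"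
  by (cases p) (auto simp: rot_def has_real_derivative_iff_has_vector_derivative[symmetric]
      intro!: has_vector_derivative_Pair derivative_eq_intros)

text \<open>
  Turning a solution of \<open>a' = - b\<close>, \<open>b' = a\<close> back by the angle \<open>t\<close> stops its motion: the derivative of
  \<open>rot (- t) (w t)\<close> is zero, so this point is constant on the interval. This takes the place of a
  general uniqueness theorem for differential equations.
\<close>

lemma rotation_equation_unique:
  assumes "is_interval I" and "s \<in> I" and "t \<in> I"
    and w: "\<And>t. t \<in> I \<Longrightarrow> (w has_vector_derivative (- snd (w t), fst (w t))) (at t)"
  shows "w t = rot (t - s) (w s)"
proof -
  have "((\<lambda>t. rot (- t) (w t)) has_vector_derivative (0, 0)) (at t)" if "t \<in> I" for t
  proof -
    have a: "((\<lambda>t. fst (w t)) has_real_derivative - snd (w t)) (at t)"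
      and b: "((\<lambda>t. snd (w t)) has_real_derivative fst (w t)) (at t)"
      using has_derivative_fst[OF w[OF that, unfolded has_vector_derivative_def]]
        has_derivative_snd[OF w[OF that, unfolded has_vector_derivative_def]]
      by (simp_all add: has_real_derivative_iff_has_vector_derivative has_vector_derivative_def)
    show ?thesis
      unfolding rot_def case_prod_beta
      by (intro has_vector_derivative_Pair)
        (auto simp: has_real_derivative_iff_has_vector_derivative[symmetric]
          intro!: derivative_eq_intros a b)
  qed
  then have "\<exists>c. \<forall>t\<in>I. rot (- t) (w t) = c"
    using assms(1)
    by (intro has_derivative_zero_constant)
      (auto simp: is_interval_convex has_vector_derivative_def zero_prod_def
        intro: has_derivative_at_withinI)
  then have "rot (- t) (w t) = rot (- s) (w s)"
    using assms(2,3) by metis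
  then have "rot t (rot (- t) (w t)) = rot t (rot (- s) (w s))"
    by simp
  then show ?thesis by (simp add: rot_rot)
qed


section \<open>Polynomial maps of the plane\<close>

definition planar_map :: "bipoly \<Rightarrow> bipoly \<Rightarrow> real \<times> real \<Rightarrow> real \<times> real" where
  "planar_map f1 f2 = (\<lambda>(x, y). (eval2 f1 x y, eval2 f2 x y))"

text \<open>
  The partial derivatives assemble into the total derivative, as the inverse function theorem and the
  chain rule for \<open>F\<close> require.
\<close>

lemma eval2_has_derivative:
  "((\<lambda>z. eval2 p (fst z) (snd z)) has_derivative
     (\<lambda>h. eval2 (dx p) x y * fst h + eval2 (dy p) x y * snd h)) (at (x, y))"
proof (induction p)
  case 0
  then show ?case by (simp add: dx_def dy_def)
next
  case (pCons a p)
  have *: "eval2 (dx (pCons a p)) x y = poly (pderiv a) x + y * eval2 (dx p) x y"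
    "eval2 (dy (pCons a p)) x y = eval2 p x y + y * eval2 (dy p) x y"
    by (simp_all add: dx_def dy_def eval2_pCons map_poly_pCons pderiv_pCons)
  have "((poly a \<circ> fst) has_derivative ((*) (poly (pderiv a) x) \<circ> fst)) (at (x, y))"
    using poly_DERIV[of a x] unfolding has_field_derivative_def
    by (intro diff_chain_at) (auto intro!: derivative_eq_intros)
  then show ?case
    unfolding eval2_pCons *
    by (auto simp: o_def algebra_simps intro!: derivative_eq_intros pCons.IH)
qed

lemma det_jacobian2:
  "det (jacobian2 f1 f2 x y) =
     eval2 (dx f1) x y * eval2 (dy f2) x y - eval2 (dy f1) x y * eval2 (dx f2) x y"
  by (simp add: jacobian2_def det_2)


section \<open>Hamiltonian systems conjugate to a rotation\<close>

locale unimodular_bijection =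
  fixes f1 f2 H :: bipoly
  assumes det: "\<And>x y. det (jacobian2 f1 f2 x y) = 1"
    and bij: "bij (planar_map f1 f2)"
    and origin: "planar_map f1 f2 (0, 0) = (0, 0)"
    and H: "H = PC (1 / 2) * (f1\<^sup>2 + f2\<^sup>2)"
begin

abbreviation F where "F \<equiv> planar_map f1 f2"

definition DF :: "real \<times> real \<Rightarrow> real \<times> real \<Rightarrow> real \<times> real" where
  "DF = (\<lambda>(x, y) (h, k).
     (eval2 (dx f1) x y * h + eval2 (dy f1) x y * k,
      eval2 (dx f2) x y * h + eval2 (dy f2) x y * k))"

text \<open>
  The adjugate of the Jacobian matrix, which is its inverse because the determinant is \<open>1\<close>.
\<close>

definition adjDF :: "real \<times> real \<Rightarrow> real \<times> real \<Rightarrow> real \<times> real" where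
  "adjDF = (\<lambda>(x, y) (h, k).
     (eval2 (dy f2) x y * h - eval2 (dy f1) x y * k,
      - eval2 (dx f2) x y * h + eval2 (dx f1) x y * k))"

lemma det_eq_1:
  "eval2 (dx f1) x y * eval2 (dy f2) x y - eval2 (dy f1) x y * eval2 (dx f2) x y = 1"
  using det[of x y] by (simp add: det_jacobian2)

lemma DF_adjDF: "DF z (adjDF z v) = v"
proof -
  obtain x y h k where z: "z = (x, y)" "v = (h, k)" by (cases z, cases v)
  define a b c d where abcd: "a = eval2 (dx f1) x y" "b = eval2 (dy f1) x y"
    "c = eval2 (dx f2) x y" "d = eval2 (dy f2) x y"
  have 1: "a * d - b * c = 1" using det_eq_1 abcd by simp
  have "DF z (adjDF z v) = ((a * d - b * c) * h, (a * d - b * c) * k)"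
    by (simp add: DF_def adjDF_def z abcd algebra_simps)
  then show ?thesis by (simp add: 1 z)
qed

lemma F_has_derivative: "(F has_derivative DF z) (at z)"
  using has_derivative_Pair[OF eval2_has_derivative[of f1 "fst z" "snd z"]
      eval2_has_derivative[of f2 "fst z" "snd z"]]
  by (simp add: planar_map_def DF_def case_prod_beta')

text \<open>
  Continuity of the inverse need not be known beforehand: \<open>F\<close> is an open map near every point where its
  derivative is invertible (a consequence of Brouwer's fixed point theorem).
\<close>

lemma inv_F_has_derivative: "(inv F has_derivative adjDF z) (at (F z))"
proof (rule has_derivative_inverse_strong[where S = UNIV and f = F and x = z and f' = "DF z"])
  show "continuous_on UNIV F"
    by (meson F_has_derivative continuous_at_imp_continuous_on has_derivative_continuous)
  show "DF z \<circ> adjDF z = id"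
    by (auto simp: DF_adjDF)
qed (auto simp: F_has_derivative bij_is_inj[OF bij] inv_f_f)

lemma eval2_dx_H: "eval2 (dx H) x y = eval2 f1 x y * eval2 (dx f1) x y + eval2 f2 x y * eval2 (dx f2) x y"
proof (rule DERIV_unique[OF has_real_derivative_dx])
  show "((\<lambda>t. eval2 H t y) has_real_derivative
      eval2 f1 x y * eval2 (dx f1) x y + eval2 f2 x y * eval2 (dx f2) x y) (at x)"
    unfolding H by (auto intro!: derivative_eq_intros has_real_derivative_dx)
qed

lemma eval2_dy_H: "eval2 (dy H) x y = eval2 f1 x y * eval2 (dy f1) x y + eval2 f2 x y * eval2 (dy f2) x y"
proof (rule DERIV_unique[OF has_real_derivative_dy])
  show "((\<lambda>t. eval2 H x t) has_real_derivative
      eval2 f1 x y * eval2 (dy f1) x y + eval2 f2 x y * eval2 (dy f2) x y) (at y)"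
    unfolding H by (auto intro!: derivative_eq_intros has_real_derivative_dy)
qed

text \<open>
  By the chain rule \<open>H_x\<close> and \<open>H_y\<close> are combinations of \<open>f1\<close> and \<open>f2\<close> whose coefficients are the columns
  of the Jacobian matrix; the quarter turn \<open>(- H_y, H_x)\<close> rearranges them into the adjugate applied to
  the quarter turn of \<open>F\<close>. This identity is what conjugates the system to the rotation.
\<close>

lemma ham_field_eq_adjDF: "ham_field H z = adjDF z (- snd (F z), fst (F z))"
  by (cases z) (simp add: ham_field_def adjDF_def planar_map_def eval2_dx_H eval2_dy_H)

lemma DF_ham_field: "DF z (ham_field H z) = (- snd (F z), fst (F z))"
  by (simp add: ham_field_eq_adjDF DF_adjDF)

lemma F_inv [simp]: "F (inv F z) = z" and inv_F [simp]: "inv F (F z) = z"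
  using bij by (simp_all add: bij_is_surj bij_is_inj surj_f_inv_f inv_f_f)

lemma F_eq_origin_iff: "F z = (0, 0) \<longleftrightarrow> z = (0, 0)"
  using inv_F origin by metis

definition flow :: "real \<Rightarrow> real \<times> real \<Rightarrow> real \<times> real" where
  "flow t z = inv F (rot t (F z))"

lemma F_flow: "F (flow t z) = rot t (F z)"
  by (simp add: flow_def)

lemma flow_zero [simp]: "flow 0 z = z"
  by (simp add: flow_def)

lemma flow_flow: "flow s (flow t z) = flow (s + t) z"
  by (simp add: flow_def rot_rot)

lemma flow_2pi: "flow (t + 2 * pi) z = flow t z"
  by (simp add: flow_def)

lemma flow_origin_iff: "flow t z = (0, 0) \<longleftrightarrow> z = (0, 0)"
proof -
  have "flow t (0, 0) = (0, 0)" for t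
    using F_flow F_eq_origin_iff origin by (metis rot_origin)
  then show ?thesis
    using flow_flow[of "- t" t z] by auto
qed

lemma flow_fixes_imp_cos_eq_1: "flow t z = z \<Longrightarrow> z \<noteq> (0, 0) \<Longrightarrow> cos t = 1"
  using F_flow[of t z] F_eq_origin_iff rot_fixes_imp_cos_eq_1 by metis

lemma flow_has_vector_derivative:
  "((\<lambda>t. flow t z) has_vector_derivative ham_field H (flow t z)) (at t)"
proof -
  have "(inv F has_derivative adjDF (flow t z)) (at (rot t (F z)))"
    using inv_F_has_derivative[of "flow t z"] by (simp add: F_flow)
  from vector_derivative_diff_chain_within[OF rot_has_vector_derivative
      has_derivative_at_withinI[OF this]]
  show ?thesis
    by (simp add: o_def flow_def[symmetric] ham_field_eq_adjDF F_flow)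
qed

lemma ham_solution_flow: "ham_solution H UNIV (\<lambda>t. flow t z)"
  by (simp add: ham_solution_def flow_has_vector_derivative)

text \<open>
  Along any solution \<open>F\<close> satisfies the rotation equation, so uniqueness for the latter determines the
  solution on its whole interval, whether or not that interval is maximal.
\<close>

lemma ham_solution_eq_flow:
  assumes u: "ham_solution H I u" and "s \<in> I" and "t \<in> I"
  shows "u t = flow (t - s) (u s)"
proof -
  have "((\<lambda>t. F (u t)) has_vector_derivative (- snd (F (u t)), fst (F (u t)))) (at t)"
    if "t \<in> I" for t
  proof -
    have "(u has_vector_derivative ham_field H (u t)) (at t)"
      using u that by (simp add: ham_solution_def)
    from vector_derivative_diff_chain_within[OF this
        has_derivative_at_withinI[OF F_has_derivative]]
    show ?thesis by (simp add: o_def DF_ham_field)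
  qed
  then have "F (u t) = rot (t - s) (F (u s))"
    using assms by (intro rotation_equation_unique[where I = I]) (auto simp: ham_solution_def)
  then show ?thesis
    by (metis flow_def inv_F)
qed

text \<open>
  The flow line is not constant because the rotation by \<open>\<pi>\<close> moves every point but the origin.
\<close>

lemma nonconst_periodic_flow:
  assumes "z \<noteq> (0, 0)"
  shows "nonconst_periodic_solution H (\<lambda>t. flow t z)"
proof -
  have "flow pi z \<noteq> flow 0 z"
    using assms flow_fixes_imp_cos_eq_1[of pi z] by auto
  moreover have "\<exists>T>0. \<forall>t. flow (t + T) z = flow t z"
    using flow_2pi pi_gt_zero by (intro exI[of _ "2 * pi"]) auto
  ultimately show ?thesis
    unfolding nonconst_periodic_solution_def periodic_solution_def
    using ham_solution_flow by metis
qed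

lemma center: "center H"
proof -
  have "ham_field H (0, 0) = (0, 0)"
    by (simp add: ham_field_eq_adjDF origin adjDF_def)
  moreover have "z \<in> \<Union>{S. nonconst_periodic_orbit H S \<and> S \<subseteq> UNIV - {(0, 0)}}"
    if "z \<noteq> (0, 0)" for z
  proof (rule UnionI)
    have "nonconst_periodic_orbit H (range (\<lambda>t. flow t z))"
      using nonconst_periodic_flow[OF that] unfolding nonconst_periodic_orbit_def by blast
    moreover have "flow t z \<noteq> (0, 0)" for t
      using that by (simp add: flow_origin_iff)
    then have "range (\<lambda>t. flow t z) \<subseteq> UNIV - {(0, 0)}"
      by (intro image_subsetI) simp
    ultimately show "range (\<lambda>t. flow t z) \<in> {S. nonconst_periodic_orbit H S \<and> S \<subseteq> UNIV - {(0, 0)}}"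
      by simp
    show "z \<in> range (\<lambda>t. flow t z)"
      by (metis flow_zero rangeI)
  qed
  ultimately show ?thesis
    unfolding center_def by (intro conjI exI[of _ UNIV]) auto
qed

text \<open>
  A period \<open>S\<close> has \<open>cos S = 1\<close>, hence is a multiple of \<open>2\<pi>\<close>.
\<close>

lemma flow_minimal_period:
  assumes "z \<noteq> (0, 0)"
  shows "minimal_period (\<lambda>t. flow t z) (2 * pi)"
proof -
  have no_period: False if "0 < S" "S < 2 * pi" "\<forall>t. flow (t + S) z = flow t z" for S
  proof -
    have "flow S z = z" using that(3)[rule_format, of 0] by simp
    then have "cos S = 1" using assms flow_fixes_imp_cos_eq_1 by blast
    then obtain m :: int where m: "S = m * 2 * pi" by (auto simp: cos_one_2pi_int)
    have "0 < m" "m < 1"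
      using that(1,2) m by (simp_all add: zero_less_mult_iff)
    then show False by linarith
  qed
  have "0 < 2 * pi" by simp
  with no_period flow_2pi show ?thesis
    unfolding minimal_period_def by blast
qed

lemma isochronous_center: "isochronous_center H"
proof -
  have "minimal_period u (2 * pi)"
    if "nonconst_periodic_solution H u" "range u \<subseteq> UNIV - {(0, 0)}" for u
  proof -
    have sol: "ham_solution H UNIV u"
      using that by (simp add: nonconst_periodic_solution_def periodic_solution_def)
    have "u = (\<lambda>t. flow t (u 0))"
    proof
      show "u t = flow t (u 0)" for t
        using ham_solution_eq_flow[OF sol, of 0 t] by simp
    qed
    moreover have "u 0 \<noteq> (0, 0)" using that(2) by auto
    ultimately show ?thesis using flow_minimal_period by metis
  qed
  then show ?thesis
    unfolding isochronous_center_def using center by blast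
qed

lemma trivial_isochronous_center: "trivial_isochronous_center H"
  using isochronous_center det H origin
  unfolding trivial_isochronous_center_def planar_map_def by auto

lemma global_center: "global_center H"
proof -
  have "nonconst_periodic_orbit H S" if orb: "is_orbit H S" and S: "S \<subseteq> - {(0, 0)}" for S
  proof -
    obtain I u where u: "maximal_solution H I u" and Su: "S = u ` I"
      using orb by (auto simp: is_orbit_def)
    then have sol: "ham_solution H I u" by (simp add: maximal_solution_def)
    then obtain s where s: "s \<in> I" by (auto simp: ham_solution_def)
    define z where "z = flow (- s) (u s)"
    have uz: "u t = flow t z" if "t \<in> I" for t
      using ham_solution_eq_flow[OF sol s that] by (simp add: z_def flow_flow)
    \<comment> \<open>the flow line through \<open>z\<close> extends \<open>u\<close> to all times, so maximality leaves no choice for \<open>I\<close>\<close>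
    have maximal: "\<forall>J w. ham_solution H J w \<and> I \<subseteq> J \<and> (\<forall>t\<in>I. w t = u t) \<longrightarrow> J = I"
      using u by (simp add: maximal_solution_def)
    have "UNIV = I"
      using maximal[rule_format, of UNIV "\<lambda>t. flow t z"] ham_solution_flow[of z] uz by simp
    then have S_eq: "S = range (\<lambda>t. flow t z)"
      using Su uz by auto
    have "u s \<in> S"
      using Su s by simp
    then have "z \<noteq> (0, 0)"
      using S by (auto simp: z_def flow_origin_iff)
    then show ?thesis
      using nonconst_periodic_flow S_eq unfolding nonconst_periodic_orbit_def by blast
  qed
  then show ?thesis
    unfolding global_center_def using center by blast
qed

end


section \<open>Total degrees\<close>

lemma finite_support: "finite {i + j | i j. coeff (coeff p j) i \<noteq> (0 :: real)}"
proof (rule finite_subset)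
  show "{i + j | i j. coeff (coeff p j) i \<noteq> 0}
      \<subseteq> (\<lambda>(j, i). i + j) ` (SIGMA j:{..degree p}. {..degree (coeff p j)})"
  proof clarsimp
    fix i j assume "coeff (coeff p j) i \<noteq> 0"
    then have "j \<le> degree p" "i \<le> degree (coeff p j)"
      by (auto intro: le_degree)
    then show "i + j \<in> (\<lambda>(j, i). i + j) ` (SIGMA j:{..degree p}. {..degree (coeff p j)})"
      by (intro image_eqI[of _ _ "(j, i)"]) auto
  qed
qed auto

lemma total_degree_le_iff:
  "total_degree p \<le> d \<longleftrightarrow> (\<forall>i j. coeff (coeff p j) i \<noteq> 0 \<longrightarrow> i + j \<le> d)"
  unfolding total_degree_def using finite_support[of p] by (subst Max_le_iff) auto

lemma le_total_degree: "coeff (coeff p j) i \<noteq> 0 \<Longrightarrow> i + j \<le> total_degree p"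
  using total_degree_le_iff[of p "total_degree p"] by blast

lemma total_degree_add_le:
  assumes "total_degree p \<le> d" and "total_degree q \<le> d"
  shows "total_degree (p + q) \<le> d"
  using assms unfolding total_degree_le_iff by (metis add_0 coeff_add)

lemma total_degree_sum_le:
  assumes "\<And>a. a \<in> A \<Longrightarrow> total_degree (g a) \<le> d"
  shows "total_degree (sum g A) \<le> d"
  using assms
proof (induction A rule: infinite_finite_induct)
  case (insert a A)
  then show ?case by (simp add: total_degree_add_le)
qed (simp_all add: total_degree_le_iff)

lemma total_degree_mult_le:
  assumes p: "total_degree p \<le> d" and q: "total_degree q \<le> e"
  shows "total_degree (p * q) \<le> d + e"
  unfolding total_degree_le_iff
proof (intro allI impI)
  fix i j assume "coeff (coeff (p * q) j) i \<noteq> 0"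
  then obtain b a where "b \<le> j" "a \<le> i"
    and "coeff (coeff p b) a \<noteq> 0" "coeff (coeff q (j - b)) (i - a) \<noteq> 0"
    by (auto simp: coeff_mult coeff_sum elim!: sum.not_neutral_contains_not_neutral)
  then have "a + b \<le> d" "(i - a) + (j - b) \<le> e"
    using p q unfolding total_degree_le_iff by blast+
  with \<open>b \<le> j\<close> \<open>a \<le> i\<close> show "i + j \<le> d + e" by linarith
qed

lemma total_degree_dx_le: "total_degree p \<le> d \<Longrightarrow> total_degree (dx p) \<le> d - 1"
  unfolding total_degree_le_iff dx_def by (fastforce simp: coeff_map_poly coeff_pderiv)

lemma total_degree_dy_le: "total_degree p \<le> d \<Longrightarrow> total_degree (dy p) \<le> d - 1"
  unfolding total_degree_le_iff dy_def by (fastforce simp: coeff_pderiv of_nat_poly)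

text \<open>
  It is enough to find one monomial of top degree that the derivative in \<open>y\<close> does not kill, and a pure
  power of \<open>y\<close> is one.
\<close>

lemma system_degree_eqI:
  assumes "total_degree H \<le> d" and "d > 0" and "coeff (coeff H d) 0 \<noteq> 0"
  shows "system_degree H = d - 1"
proof -
  have "coeff (coeff (dy H) (d - 1)) 0 \<noteq> 0"
    using assms(2,3) by (simp add: dy_def coeff_pderiv of_nat_poly)
  from le_total_degree[OF this] show ?thesis
    unfolding system_degree_def
    using total_degree_dx_le[OF assms(1)] total_degree_dy_le[OF assms(1)] by simp
qed

text \<open>
  Unlike \<open>coeff_mult_degree_sum\<close>, this allows upper bounds in place of the exact degrees, so that the
  case of a vanishing top coefficient (such as \<open>lam = 0\<close> in \<open>f2\<close>) needs no separate treatment.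
\<close>

lemma coeff_mult_at_degree_bounds:
  assumes "degree p \<le> m" and "degree q \<le> n"
  shows "coeff (p * q) (m + n) = coeff p m * coeff q n"
proof -
  have "coeff (p * q) (m + n) = (\<Sum>i\<le>m + n. coeff p i * coeff q (m + n - i))"
    by (rule coeff_mult)
  also have "\<dots> = (\<Sum>i\<in>{m}. coeff p i * coeff q (m + n - i))"
  proof (rule sum.mono_neutral_right)
    show "\<forall>i\<in>{..m + n} - {m}. coeff p i * coeff q (m + n - i) = 0"
    proof
      fix i assume "i \<in> {..m + n} - {m}"
      then have "i > m \<or> m + n - i > n" by auto
      then show "coeff p i * coeff q (m + n - i) = 0"
        using assms by (auto simp: coeff_eq_0)
    qed
  qed auto
  finally show ?thesis by simp
qed


section \<open>The triangular maps\<close>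

lemma coeff_PX: "coeff PX j = (if j = 0 then [:0, 1:] else 0)"
  by (auto simp: PX_def coeff_pCons split: nat.split)

lemma PC_1 [simp]: "PC 1 = 1"
  by (simp add: PC_def one_pCons)

lemma coeff_PC_PY_power: "coeff (PC a * PY ^ i) j = (if j = i then [:a:] else 0)"
proof -
  have "PC a * PY ^ i = monom [:a:] i"
    by (simp add: PC_def PY_def monom_altdef)
  then show ?thesis by simp
qed

lemma total_degree_PC_PY_power: "total_degree (PC a * PY ^ i) \<le> i"
  unfolding total_degree_le_iff coeff_PC_PY_power by (auto simp: coeff_pCons split: nat.splits)

lemma total_degree_PX: "total_degree PX \<le> 1"
  unfolding total_degree_le_iff coeff_PX by (auto simp: coeff_pCons split: nat.splits)

lemma degree_le_total_degree: "degree p \<le> total_degree p"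
proof (rule degree_le, intro allI impI)
  fix j assume "j > total_degree p"
  then have "coeff (coeff p j) i = 0" for i
    using le_total_degree[of p j i] by linarith
  then show "coeff p j = 0" by (simp add: poly_eq_iff)
qed

theorem theorem2p1:
  fixes k n :: nat and lam :: real and c :: "nat \<Rightarrow> real"
    and f1 f2 H :: bipoly
  assumes "k \<ge> 2"
    and "n = 2 * k - 1"
    and "f1 = PX + (\<Sum>i=2..k. PC (c i) * PY ^ i)"
    and "f2 = PY + PC lam * f1"
    and "H = PC (1 / 2) * (f1\<^sup>2 + f2\<^sup>2)"
  shows "(\<forall>x y. det (jacobian2 f1 f2 x y) = 1)
    \<and> trivial_isochronous_center H
    \<and> (c k \<noteq> 0 \<longrightarrow> system_degree H = n)
    \<and> inj (\<lambda>(x, y). (eval2 f1 x y, eval2 f2 x y))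
    \<and> global_center H"
proof -
  define g where "g y = (\<Sum>i=2..k. c i * y ^ i)" for y
  have f1: "eval2 f1 x y = x + g y" for x y
    by (simp add: assms(3) g_def)
  have f2: "eval2 f2 x y = y + lam * eval2 f1 x y" for x y
    by (simp add: assms(4))
  have dx_f1: "eval2 (dx f1) x y = 1" for x y
    by (rule DERIV_unique[OF has_real_derivative_dx])
      (auto simp: f1 intro!: derivative_eq_intros)
  have dx_f2: "eval2 (dx f2) x y = lam * eval2 (dx f1) x y" for x y
    by (rule DERIV_unique[OF has_real_derivative_dx])
      (auto simp: f2 intro!: derivative_eq_intros has_real_derivative_dx)
  have dy_f2: "eval2 (dy f2) x y = 1 + lam * eval2 (dy f1) x y" for x y
    by (rule DERIV_unique[OF has_real_derivative_dy])
      (auto simp: f2 intro!: derivative_eq_intros has_real_derivative_dy)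
  have det: "det (jacobian2 f1 f2 x y) = 1" for x y
    by (simp add: det_jacobian2 dx_f1 dx_f2 dy_f2)
  have bij: "bij (planar_map f1 f2)"
  proof (rule o_bij)
    let ?G = "\<lambda>(a, b). (a - g (b - lam * a), b - lam * a)"
    show "?G \<circ> planar_map f1 f2 = id" "planar_map f1 f2 \<circ> ?G = id"
      by (auto simp: planar_map_def f1 f2)
  qed
  have "g 0 = 0"
    unfolding g_def by (intro sum.neutral) auto
  then have origin: "planar_map f1 f2 (0, 0) = (0, 0)"
    by (simp add: planar_map_def f1 f2)
  interpret unimodular_bijection f1 f2 H
    by unfold_locales (fact det bij origin assms(5))+
  have "system_degree H = n" if "c k \<noteq> 0"
  proof -
    have const: "total_degree (PC a) \<le> 0" for a
      using total_degree_PC_PY_power[of a 0] by simp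
    have "total_degree f1 \<le> k"
      unfolding assms(3) using \<open>k \<ge> 2\<close>
      by (intro total_degree_add_le total_degree_sum_le
          order_trans[OF total_degree_PC_PY_power] order_trans[OF total_degree_PX]) auto
    moreover have "total_degree PY \<le> 1"
      using total_degree_PC_PY_power[of 1 1] by simp
    ultimately have deg: "total_degree f1 \<le> k" "total_degree f2 \<le> k"
      unfolding assms(4) using total_degree_mult_le[OF const, of f1 k lam] \<open>k \<ge> 2\<close>
      by (auto intro!: total_degree_add_le)
    have "coeff f1 k = [:c k:]"
      using \<open>k \<ge> 2\<close> by (simp add: assms(3) coeff_sum coeff_PX coeff_PC_PY_power)
    moreover have "coeff PY k = 0"
      using \<open>k \<ge> 2\<close> coeff_PC_PY_power[of 1 1 k] by simp
    ultimately have top: "coeff f1 k = [:c k:]" "coeff f2 k = [:lam * c k:]"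
      by (simp_all add: assms(4) PC_def)
    have "degree f1 \<le> k" "degree f2 \<le> k"
      using deg degree_le_total_degree order_trans by blast+
    then have "coeff H (k + k) = [:(1 + lam\<^sup>2) * (c k)\<^sup>2 / 2:]"
      by (simp add: assms(5) PC_def power2_eq_square top coeff_mult_at_degree_bounds
          algebra_simps add_divide_distrib)
    moreover have "1 + lam\<^sup>2 \<noteq> 0"
      by (smt (verit) zero_le_power2)
    ultimately have "coeff (coeff H (k + k)) 0 \<noteq> 0"
      using that by simp
    moreover have "total_degree H \<le> k + k"
      unfolding assms(5) power2_eq_square
      using total_degree_mult_le[OF const total_degree_add_le[OF
            total_degree_mult_le[OF deg(1) deg(1)] total_degree_mult_le[OF deg(2) deg(2)]]]
      by simp
    ultimately show ?thesis
      using system_degree_eqI[of H "k + k"] \<open>k \<ge> 2\<close> assms(2) by (simp add: mult_2)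
  qed
  moreover have "inj (\<lambda>(x, y). (eval2 f1 x y, eval2 f2 x y))"
    using bij_is_inj[OF bij] by (simp add: planar_map_def)
  ultimately show ?thesis
    using det trivial_isochronous_center global_center by blast
qed

end
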